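(* For all $\beta_1,\beta_2>1$ with $\beta_1\neq\beta_2$, the set of uniqueness $\mathcal U_{\beta_1,\beta_2}\subset\mathbb R^2$ has no interior points.
   Context: Write $p=+1$, $m=-1$. For $\beta_1,\beta_2>1$ define $\pi:\{p,m\}^{\mathbb N}\to\mathbb R^2$ by $\pi(w)=\left(\sum_{i\ge1}w_i\beta_1^{-i},\sum_{i\ge1}w_i\beta_2^{-i}\right)$. Let $U_{\beta_1,\beta_2}$ be the set of unique addresses, i.e. of $w\in\{p,m\}^{\mathbb N}$ such that $\pi(w')\ne\pi(w)$ for every $w'\in\{p,m\}^{\mathbb N}$ with $w'\neq w$. The set of uniqueness is $\mathcal U_{\beta_1,\beta_2}=\pi(U_{\beta_1,\beta_2})$. *)

theory Defs
  imports "HOL-Analysis.Analysis"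
begin

text \<open>The letters \<open>p\<close> and \<open>m\<close> are identified with their values \<open>1\<close> and \<open>-1\<close>.
  Sequences are indexed from 0, so the entry \<open>w i\<close> is the letter with number \<open>i + 1\<close>
  of the word and carries the weight \<open>\<beta>\<close> to the power \<open>-(i + 1)\<close>.\<close>

definition pm_words :: "(nat \<Rightarrow> real) set" where
  "pm_words = {w. \<forall>i. w i \<in> {1, -1}}"

definition pm_proj :: "real \<Rightarrow> real \<Rightarrow> (nat \<Rightarrow> real) \<Rightarrow> real \<times> real" where
  "pm_proj \<beta>\<^sub>1 \<beta>\<^sub>2 w = (\<Sum>i. w i / \<beta>\<^sub>1 ^ Suc i, \<Sum>i. w i / \<beta>\<^sub>2 ^ Suc i)"

definition unique_addresses :: "real \<Rightarrow> real \<Rightarrow> (nat \<Rightarrow> real) set" where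
  "unique_addresses \<beta>\<^sub>1 \<beta>\<^sub>2 =
    {w \<in> pm_words. \<forall>w' \<in> pm_words. w' \<noteq> w \<longrightarrow> pm_proj \<beta>\<^sub>1 \<beta>\<^sub>2 w' \<noteq> pm_proj \<beta>\<^sub>1 \<beta>\<^sub>2 w}"

definition uniqueness_set :: "real \<Rightarrow> real \<Rightarrow> (real \<times> real) set" where
  "uniqueness_set \<beta>\<^sub>1 \<beta>\<^sub>2 = pm_proj \<beta>\<^sub>1 \<beta>\<^sub>2 ` unique_addresses \<beta>\<^sub>1 \<beta>\<^sub>2"

end

theory Submission
  imports Defs
begin

text \<open>The space of words is compact and totally disconnected, and the projection is continuous on
  it. On a set whose points all have exactly one address, inverting the projection is therefore
  continuous, because a continuous map from a compact space to a Hausdorff space is closed, and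
  stays closed when it is restricted to the full preimage of a set. The inverse
  carries connected sets to connected sets of words, that is, to single words. Hence the set of uniqueness contains no connected set with two points, and in particular
  no ball of positive radius. The argument is carried out one letter at a time in
  \<open>connected_unique_address_eq\<close>; it applies to every continuous coding by words.\<close>

lemma pm_words_cases:
  assumes "w \<in> pm_words"
  shows "w i = 1 \<or> w i = -1"
  using assms by (simp add: pm_words_def)

lemma pm_words_eq_PiE: "pm_words = (\<Pi>\<^sub>E i\<in>UNIV. {1, -1})"
  by (auto simp: pm_words_def PiE_def)

lemma compact_pm_words: "compact pm_words"
proof -
  have "compactin (product_topology (\<lambda>i. euclidean) UNIV) (\<Pi>\<^sub>E i\<in>(UNIV :: nat set). {1, -1 :: real})"
    by (simp add: compactin_PiE)
  then show ?thesis
    by (simp add: pm_words_eq_PiE euclidean_product_topology)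
qed

lemma continuous_on_pm_series:
  fixes \<beta> :: real
  assumes "\<beta> > 1"
  shows "continuous_on pm_words (\<lambda>w. \<Sum>i. w i / \<beta> ^ Suc i)"
proof (rule uniform_limit_theorem)
  show "uniform_limit pm_words (\<lambda>n w. \<Sum>i<n. w i / \<beta> ^ Suc i) (\<lambda>w. \<Sum>i. w i / \<beta> ^ Suc i) sequentially"
  proof (rule Weierstrass_m_test)
    show "norm (w i / \<beta> ^ Suc i) \<le> (1 / \<beta>) ^ Suc i" if "w \<in> pm_words" for i w
    proof -
      have "\<bar>w i\<bar> = 1"
        using pm_words_cases[OF that, of i] by auto
      then show ?thesis
        using assms by (simp add: power_one_over abs_mult power_abs)
    qed
    have "summable (\<lambda>i. (1 / \<beta>) ^ i)"
      using assms by (intro summable_geometric) simp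
    then show "summable (\<lambda>i. (1 / \<beta>) ^ Suc i)"
      by (subst summable_Suc_iff)
  qed
  show "\<forall>\<^sub>F n in sequentially. continuous_on pm_words (\<lambda>w. \<Sum>i<n. w i / \<beta> ^ Suc i)"
  proof (intro always_eventually allI continuous_on_sum)
    have "continuous_on pm_words (\<lambda>w. w i)" for i
      by (rule continuous_on_subset[OF continuous_on_product_coordinates subset_UNIV])
    then show "continuous_on pm_words (\<lambda>w. w i / \<beta> ^ Suc i)" for i
      using assms by (intro continuous_on_divide continuous_on_const) simp_all
  qed
qed simp

lemma continuous_on_pm_proj:
  assumes "\<beta>\<^sub>1 > 1" and "\<beta>\<^sub>2 > 1"
  shows "continuous_on pm_words (pm_proj \<beta>\<^sub>1 \<beta>\<^sub>2)"
  unfolding pm_proj_def[abs_def] using assms by (intro continuous_on_Pair continuous_on_pm_series)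

text \<open>For each index, the points of a connected set that have an address with letter \<open>1\<close> there and
  those that have one with letter \<open>-1\<close> form two relatively closed sets, as images of compact sets
  of words. They cover the connected set, and uniqueness of addresses makes them disjoint; so one
  of them is empty, and every letter is constant.\<close>

lemma connected_unique_address_eq:
  fixes f :: "(nat \<Rightarrow> real) \<Rightarrow> 'a::t2_space"
  assumes cont: "continuous_on pm_words f"
    and conn: "connected (f ` W)"
    and W: "W \<subseteq> pm_words"
    and unique: "\<And>w w'. w \<in> W \<Longrightarrow> w' \<in> pm_words \<Longrightarrow> f w' = f w \<Longrightarrow> w' = w"
    and "u \<in> W" "v \<in> W"
  shows "u = v"
proof
  fix i
  define A where "A s = f ` (pm_words \<inter> {w. w i = s})" for s :: real
  have closed_A: "closed (A s)" for s
  proof -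
    have "closed {w :: nat \<Rightarrow> real. w i = s}"
      by (intro closed_Collect_eq continuous_on_product_coordinates continuous_on_const)
    then have "compact (pm_words \<inter> {w. w i = s})"
      using compact_pm_words by (rule compact_Int_closed[rotated])
    then show ?thesis
      unfolding A_def
      by (intro compact_imp_closed compact_continuous_image continuous_on_subset[OF cont]) auto
  qed
  have letter: "w i = s" if "w \<in> W" "f w \<in> A s" for w s
    using that unique[OF \<open>w \<in> W\<close>] by (auto simp: A_def)
  have cover: "w i = 1 \<and> f w \<in> A 1 \<or> w i = -1 \<and> f w \<in> A (-1)" if "w \<in> W" for w
    using W that pm_words_cases[of w i] by (auto simp: A_def)
  have "w i \<noteq> 1 \<or> w i \<noteq> -1" for w :: "nat \<Rightarrow> real"
    by simp
  then have "A 1 \<inter> A (-1) \<inter> f ` W = {}"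
    using letter by blast
  moreover have "f ` W \<subseteq> A 1 \<union> A (-1)"
    using cover by blast
  ultimately have "A 1 \<inter> f ` W = {} \<or> A (-1) \<inter> f ` W = {}"
    using conn closed_A by (intro connected_closedD)
  then show "u i = v i"
    using cover[OF \<open>u \<in> W\<close>] cover[OF \<open>v \<in> W\<close>] \<open>u \<in> W\<close> \<open>v \<in> W\<close> by auto
qed

theorem proposition4p4:
  fixes \<beta>\<^sub>1 \<beta>\<^sub>2 :: real
  assumes "\<beta>\<^sub>1 > 1" and "\<beta>\<^sub>2 > 1" and "\<beta>\<^sub>1 \<noteq> \<beta>\<^sub>2"
  shows "interior (uniqueness_set \<beta>\<^sub>1 \<beta>\<^sub>2) = {}"
proof (rule equals0I)
  fix x assume "x \<in> interior (uniqueness_set \<beta>\<^sub>1 \<beta>\<^sub>2)"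
  then obtain e where "e > 0" and ball: "ball x e \<subseteq> uniqueness_set \<beta>\<^sub>1 \<beta>\<^sub>2"
    by (auto simp: mem_interior)
  define f where "f = pm_proj \<beta>\<^sub>1 \<beta>\<^sub>2"
  define W where "W = {w \<in> unique_addresses \<beta>\<^sub>1 \<beta>\<^sub>2. f w \<in> ball x e}"
  have image: "f ` W = ball x e"
    using ball by (auto simp: W_def f_def uniqueness_set_def)
  have single: "u = v" if "u \<in> W" "v \<in> W" for u v
  proof (rule connected_unique_address_eq)
    show "continuous_on pm_words f"
      using assms by (simp add: f_def continuous_on_pm_proj)
    show "connected (f ` W)"
      by (simp add: image convex_connected)
    show "W \<subseteq> pm_words"
      by (auto simp: W_def unique_addresses_def)
    show "w' = w" if "w \<in> W" "w' \<in> pm_words" "f w' = f w" for w w'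
      using that by (auto simp: W_def unique_addresses_def f_def)
  qed (use that in auto)
  have "y = x" if "y \<in> ball x e" for y
  proof -
    have "x \<in> f ` W" "y \<in> f ` W"
      unfolding image using \<open>e > 0\<close> that by simp_all
    then show ?thesis
      using single by blast
  qed
  then have "ball x e = {x}"
    using \<open>e > 0\<close> by auto
  then show False
    by (metis not_open_singleton open_ball)
qed

end
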